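(* Let $q$ be a prime power and let $n\geq 2$ be an integer. Let $\Gamma_n(q)$ be the regular graph over $M_n(\mathbb{F}_q)$, that is, the simple graph with vertex set $GL_n(\mathbb{F}_q)$ in which two distinct matrices $a,b\in GL_n(\mathbb{F}_q)$ are joined by an edge if and only if $\det(a+b)=0$. Then the chromatic number of $\Gamma_n(q)$ satisfies \[\chi(\Gamma_n(q))\geq (1-q^{-1}-q^{-2})\,q^{n-1}.\]
   Context: $\mathbb{F}_q$ is the finite field with $q$ elements (of any characteristic, $q$ even or odd), $M_n(\mathbb{F}_q)$ is the ring of $n\times n$ matrices over $\mathbb{F}_q$, and $GL_n(\mathbb{F}_q)$ is the group of non-singular matrices in $M_n(\mathbb{F}_q)$. The chromatic number $\chi(X)$ of a finite simple graph $X$ is the least number of colors in a coloring of the vertices such that adjacent vertices receive different colors. *)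

theory Defs
  imports "HOL-Library.Cardinality" "Jordan_Normal_Form.Determinant" "Graph_Theory.Pair_Digraph"
begin

text \<open>
  A finite simple graph is a digraph in the sense of locale \<open>pair_graph\<close>: a finite vertex set
  with a symmetric, irreflexive set of arcs, each edge being present in both orientations.
\<close>

definition proper_colouring :: "'v pair_pre_digraph \<Rightarrow> ('v \<Rightarrow> 'c) \<Rightarrow> bool" where
  "proper_colouring G c \<longleftrightarrow> (\<forall>(u, v) \<in> parcs G. c u \<noteq> c v)"

definition colourable :: "'v pair_pre_digraph \<Rightarrow> nat \<Rightarrow> bool" where
  "colourable G k \<longleftrightarrow>
     (\<exists>c :: 'v \<Rightarrow> nat. c ` pverts G \<subseteq> {..<k} \<and> proper_colouring G c)"

definition chromatic_number :: "'v pair_pre_digraph \<Rightarrow> nat" where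
  "chromatic_number G = (LEAST k. colourable G k)"

text \<open>The minimum is attained, so \<open>LEAST\<close> is not taken over an empty set.\<close>

lemma pair_graph_colourable:
  assumes "pair_graph G"
  shows "colourable G (card (pverts G))"
proof -
  interpret pair_graph G by fact
  obtain c where c: "bij_betw c (pverts G) {0..<card (pverts G)}"
    using ex_bij_betw_finite_nat[OF pair_finite_verts] by blast
  have "proper_colouring G c"
    unfolding proper_colouring_def
  proof clarify
    fix u v assume uv: "(u, v) \<in> parcs G" and eq: "c u = c v"
    have "u \<in> pverts G" "v \<in> pverts G" "u \<noteq> v"
      using uv in_arcsD1 in_arcsD2 pair_no_loops by fastforce+
    with eq c show False by (auto simp: bij_betw_def inj_on_def)
  qed
  moreover have "c ` pverts G \<subseteq> {..<card (pverts G)}"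
    using c by (auto simp: bij_betw_def)
  ultimately show ?thesis unfolding colourable_def by blast
qed

lemma colourable_chromatic_number:
  "pair_graph G \<Longrightarrow> colourable G (chromatic_number G)"
  unfolding chromatic_number_def by (rule LeastI, rule pair_graph_colourable)

definition general_linear :: "nat \<Rightarrow> 'a :: field mat set" where
  "general_linear n = {A \<in> carrier_mat n n. det A \<noteq> 0}"

lemma general_linear_eq_Units:
  "general_linear n = Units (ring_mat TYPE('a :: field) n b)"
proof (intro Set.set_eqI iffI)
  fix A :: "'a mat"
  assume "A \<in> general_linear n"
  then show "A \<in> Units (ring_mat TYPE('a) n b)"
    unfolding general_linear_def by (blast intro: det_non_zero_imp_unit)
next
  fix A :: "'a mat"
  assume A: "A \<in> Units (ring_mat TYPE('a) n b)"
  then have "A \<in> carrier_mat n n"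
    by (auto simp: Units_def ring_mat_simps)
  with unit_imp_det_non_zero[OF A] show "A \<in> general_linear n"
    by (simp add: general_linear_def)
qed

definition regular_graph :: "nat \<Rightarrow> 'a :: {field, finite} mat pair_pre_digraph" where
  "regular_graph n =
     \<lparr> pverts = general_linear n,
       parcs = {(A, B). A \<in> general_linear n \<and> B \<in> general_linear n \<and> A \<noteq> B \<and> det (A + B) = 0} \<rparr>"

lemma finite_general_linear: "finite (general_linear n :: 'a :: {field, finite} mat set)"
proof -
  let ?f = "\<lambda>A :: 'a mat. restrict (\<lambda>ij. A $$ ij) ({..<n} \<times> {..<n})"
  have "inj_on ?f (general_linear n)"
  proof (rule inj_onI)
    fix A B :: "'a mat"
    assume A: "A \<in> general_linear n" and B: "B \<in> general_linear n" and eq: "?f A = ?f B"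
    show "A = B"
    proof (rule eq_matI)
      fix i j assume "i < dim_row B" "j < dim_col B"
      then show "A $$ (i, j) = B $$ (i, j)"
        using B fun_cong[OF eq, of "(i, j)"] by (auto simp: general_linear_def)
    qed (use A B in \<open>auto simp: general_linear_def\<close>)
  qed
  moreover have "finite (({..<n} \<times> {..<n}) \<rightarrow>\<^sub>E (UNIV :: 'a set))"
    by (intro finite_PiE) auto
  moreover have "?f ` general_linear n \<subseteq> ({..<n} \<times> {..<n}) \<rightarrow>\<^sub>E UNIV"
    by (intro image_subsetI restrict_PiE_iff[THEN iffD2]) simp
  ultimately show ?thesis by (meson finite_subset finite_imageD)
qed

lemma pair_graph_regular_graph:
  "pair_graph (regular_graph n :: 'a :: {field, finite} mat pair_pre_digraph)"
proof -
  let ?G = "regular_graph n :: 'a mat pair_pre_digraph"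
  have "parcs ?G \<subseteq> general_linear n \<times> general_linear n"
    by (auto simp: regular_graph_def)
  then have fin: "finite (parcs ?G)"
    using finite_general_linear finite_subset by blast
  have sym: "sym (parcs ?G)"
    by (auto simp: regular_graph_def general_linear_def comm_add_mat intro!: symI)
  show ?thesis
    by unfold_locales
      (use fin sym in \<open>auto simp: regular_graph_def finite_general_linear symmetric_def\<close>)
qed

end

theory Submission
  imports Defs "HOL-Library.Indicator_Function" "Berlekamp_Zassenhaus.Berlekamp_Type_Based"
begin

text \<open>
  Write \<open>M\<close> for the set of all \<open>n \<times> n\<close> matrices and \<open>Q = q ^ n\<close> for the number of vectors. The sum of
  two matrices \<open>A\<close> and \<open>B\<close> is singular exactly when \<open>A v = - B v\<close> for some nonzero vector \<open>v\<close>, so the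
  graph is governed by how matrices act on single vectors.

  In odd characteristic, a colour class \<open>S\<close> has \<open>A + B\<close> invertible for all \<open>A, B \<in> S\<close>, the case
  \<open>A = B\<close> included. Hence for every nonzero \<open>v\<close> the sets \<open>S v = {A v | A \<in> S}\<close> and \<open>- S v\<close> are disjoint,
  and the event \<open>X v \<in> S v\<close> for a uniformly random \<open>X \<in> M\<close> has probability at most \<open>1/2\<close>. For vectors
  \<open>v\<close> and \<open>v'\<close> that are not proportional the pair \<open>(X v, X v')\<close> is uniformly distributed, so these events
  are pairwise independent as \<open>v\<close> runs over a set of representatives of the \<open>r = (Q - 1) / (q - 1)\<close> points
  of projective space. All of them occur when \<open>X \<in> S\<close>. Chebyshev's inequality
  (\<open>pairwise_independent_events_bound\<close>) therefore gives \<open>card S \<le> card M / r\<close>. On the other hand each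
  singular matrix kills one of the representatives, so at least the fraction \<open>1 - r / Q\<close> of all matrices is
  invertible. Dividing, the chromatic number is at least \<open>r (1 - r / Q)\<close>
  (\<open>chromatic_number_normalised_bound\<close>). As \<open>r / Q\<close> lies between \<open>1/q + 1/q\<^sup>2\<close> and \<open>1/2\<close>, where
  \<open>x (1 - x)\<close> is increasing, this is at least \<open>(1 + 1/q) (1 - 1/q - 1/q\<^sup>2) q ^ (n - 1)\<close>
  (\<open>concave_count_bound\<close>).

  In characteristic two, \<open>A + B = A - B\<close> is singular as soon as \<open>A\<close> and \<open>B\<close> have a column in common, and
  the \<open>q ^ (n - 1)\<close> matrices that differ from the identity only in the first row, off the diagonal, form
  a clique (\<open>chromatic_number_char_two_bound\<close>).
\<close>

section \<open>The second moment bound\<close>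

text \<open>
  Chebyshev's inequality for the number of events that fail at a uniformly random point of \<open>\<Omega>\<close>: on \<open>S\<close>
  none fails, although the expected number \<open>\<mu>\<close> of failures is at least half the number of events.
  Pairwise independence makes the variance a sum of terms \<open>p (1 - p) \<le> (1 - p) / 2\<close>, so that it is at
  most \<open>\<mu> / 2\<close>.
\<close>

lemma pairwise_independent_events_bound:
  fixes B :: "'i \<Rightarrow> 'w set"
  assumes fin: "finite \<Omega>" "finite R"
    and sub: "\<And>r. r \<in> R \<Longrightarrow> B r \<subseteq> \<Omega>"
    and half: "\<And>r. r \<in> R \<Longrightarrow> 2 * card (B r) \<le> card \<Omega>"
    and indep: "\<And>r s. r \<in> R \<Longrightarrow> s \<in> R \<Longrightarrow> r \<noteq> s \<Longrightarrow>
       card \<Omega> * card (B r \<inter> B s) = card (B r) * card (B s)"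
    and S: "S \<subseteq> \<Omega>" "\<And>r. r \<in> R \<Longrightarrow> S \<subseteq> B r"
  shows "card S * card R \<le> card \<Omega>"
proof (cases "\<Omega> = {} \<or> R = {}")
  case True
  then show ?thesis using S by auto
next
  case False
  define N where "N = real (card \<Omega>)"
  have N: "N > 0" using False fin by (auto simp: N_def card_gt_0_iff)
  define p where "p r = real (card (B r)) / N" for r
  have p: "real (card (B r)) = N * p r" for r using N by (simp add: p_def)
  have p2: "p r \<le> 1/2" if "r \<in> R" for r
  proof -
    have "real (2 * card (B r)) \<le> real (card \<Omega>)" using half[OF that] by (rule of_nat_mono)
    then show ?thesis using N by (simp add: p_def N_def divide_simps)
  qed
  \<comment> \<open>The centred indicators are pairwise orthogonal, and minus their sum is the centred failure count.\<close>
  define g where "g r x = (indicator (B r) x :: real) - p r" for r x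
  have cov: "(\<Sum>x\<in>\<Omega>. g r x * g s x) = real (card (B r \<inter> B s)) - N * p r * p s"
    if "r \<in> R" "s \<in> R" for r s
  proof -
    have ind: "(\<Sum>x\<in>\<Omega>. indicator A x) = real (card A)" if "A \<subseteq> \<Omega>" for A
    proof -
      have "(\<Sum>x\<in>\<Omega>. indicator A x :: real) = (\<Sum>x\<in>\<Omega>. if x \<in> A then 1 else 0)"
        by (intro sum.cong) (auto simp: indicator_def)
      also have "\<dots> = (\<Sum>x\<in>\<Omega> \<inter> A. 1)" by (rule sum.inter_restrict[OF fin(1), symmetric])
      finally show ?thesis using that by (simp add: Int_absorb1)
    qed
    have "(\<Sum>x\<in>\<Omega>. g r x * g s x)
      = (\<Sum>x\<in>\<Omega>. indicator (B r \<inter> B s) x - p s * indicator (B r) x - p r * indicator (B s) x + p r * p s)"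
      by (intro sum.cong) (auto simp: g_def indicator_inter_arith algebra_simps)
    also have "\<dots> = real (card (B r \<inter> B s)) - p s * (N * p r) - p r * (N * p s) + N * (p r * p s)"
      using sub[OF that(1)] sub[OF that(2)] ind[of "B r \<inter> B s"] ind[of "B r"] ind[of "B s"]
      by (auto simp: sum.distrib sum_subtractf p simp flip: sum_distrib_left N_def)
    finally show ?thesis by (simp add: algebra_simps)
  qed
  define \<mu> where "\<mu> = (\<Sum>r\<in>R. 1 - p r)"
  have \<mu>: "\<mu> \<ge> real (card R) / 2"
    using sum_mono[of R "\<lambda>r. 1/2" "\<lambda>r. 1 - p r"] p2 by (fastforce simp: \<mu>_def)
  have "real (card S) * \<mu>\<^sup>2 = (\<Sum>x\<in>S. (\<Sum>r\<in>R. g r x)\<^sup>2)"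
  proof -
    have "(\<Sum>r\<in>R. g r x) = \<mu>" if "x \<in> S" for x
      unfolding \<mu>_def
    proof (rule sum.cong[OF refl])
      fix r assume "r \<in> R"
      then have "x \<in> B r" using S(2) that by blast
      then show "g r x = 1 - p r" by (simp add: g_def)
    qed
    then show ?thesis by simp
  qed
  also have "\<dots> \<le> (\<Sum>x\<in>\<Omega>. (\<Sum>r\<in>R. g r x)\<^sup>2)"
    using S fin by (intro sum_mono2) auto
  also have "\<dots> = (\<Sum>r\<in>R. \<Sum>s\<in>R. \<Sum>x\<in>\<Omega>. g r x * g s x)"
    unfolding power2_eq_square sum_product
    by (subst sum.swap, rule sum.cong, simp, rule sum.swap)
  also have "\<dots> = (\<Sum>r\<in>R. \<Sum>s\<in>R. if s = r then N * p r * (1 - p r) else 0)"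
  proof (intro sum.cong refl)
    fix r s assume rs: "r \<in> R" "s \<in> R"
    show "(\<Sum>x\<in>\<Omega>. g r x * g s x) = (if s = r then N * p r * (1 - p r) else 0)"
    proof (cases "s = r")
      case True
      then show ?thesis using cov[OF rs] by (simp add: p algebra_simps)
    next
      case False
      then have "real (card \<Omega> * card (B r \<inter> B s)) = real (card (B r) * card (B s))"
        using indep rs by metis
      then have "N * real (card (B r \<inter> B s)) = N * p r * (N * p s)"
        using p by (simp add: N_def)
      then have "real (card (B r \<inter> B s)) = N * p r * p s" using N by simp
      then show ?thesis using cov[OF rs] False by simp
    qed
  qed
  also have "\<dots> = (\<Sum>r\<in>R. N * p r * (1 - p r))"
    using fin by simp
  also have "\<dots> \<le> (\<Sum>r\<in>R. N / 2 * (1 - p r))"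
  proof (rule sum_mono)
    fix r assume "r \<in> R"
    then show "N * p r * (1 - p r) \<le> N / 2 * (1 - p r)"
      using p2[of r] N by (intro mult_right_mono) auto
  qed
  also have "\<dots> = N / 2 * \<mu>" by (simp only: \<mu>_def sum_distrib_left)
  finally have *: "real (card S) * \<mu>\<^sup>2 \<le> N / 2 * \<mu>" .
  have \<mu>pos: "\<mu> > 0"
    using \<mu> False fin by (smt (verit) card_gt_0_iff half_gt_zero of_nat_0_less_iff)
  have "real (card S) * \<mu> \<le> N / 2"
    using * \<mu>pos by (simp add: power2_eq_square)
  moreover have "real (card S) * (real (card R) / 2) \<le> real (card S) * \<mu>"
    using \<mu> by (intro mult_left_mono) auto
  ultimately have "real (card S) * real (card R) \<le> N" by linarith
  then show ?thesis unfolding N_def by (metis of_nat_le_iff of_nat_mult)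
qed

section \<open>Prescribing the values of a random matrix\<close>

lemma finite_carrier_mat: "finite (carrier_mat m n :: 'a :: finite mat set)"
proof -
  have "carrier_mat m n \<subseteq>
      mat_of_rows n ` {rs :: 'a vec list. set rs \<subseteq> carrier_vec n \<and> length rs = m}"
  proof
    fix A :: "'a mat" assume A: "A \<in> carrier_mat m n"
    then have "A = mat_of_rows n (rows A)" by (metis carrier_matD(2) mat_of_rows_rows)
    moreover have "set (rows A) \<subseteq> carrier_vec n" "length (rows A) = m"
      using A rows_carrier[of A] by auto
    ultimately show "A \<in> mat_of_rows n ` {rs. set rs \<subseteq> carrier_vec n \<and> length rs = m}" by blast
  qed
  then show ?thesis
    by (rule finite_subset) (intro finite_imageI finite_lists_length_eq finite_carrier_vec)
qed

text \<open>
  The hypothesis on \<open>f\<close> holds for additive maps. It says that translating by \<open>Z\<close> permutes the fibres of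
  \<open>f\<close>, which therefore all have the same size: \<open>f\<close> maps the uniform distribution to the uniform
  distribution on its image. In this form the lemma needs no addition on the codomain, where the vectors of
  a given dimension, and pairs of them, are only a carrier set.
\<close>

lemma card_fibre_translation_invariant:
  fixes f :: "'a :: {ring, finite} mat \<Rightarrow> 'b"
  assumes f: "\<And>X Y Z. X \<in> carrier_mat m n \<Longrightarrow> Y \<in> carrier_mat m n \<Longrightarrow> Z \<in> carrier_mat m n \<Longrightarrow>
      f (X + Z) = f (Y + Z) \<longleftrightarrow> f X = f Y"
    and T: "T \<subseteq> f ` carrier_mat m n"
  shows "card {X \<in> carrier_mat m n. f X \<in> T} * card (f ` carrier_mat m n)
    = card T * card (carrier_mat m n :: 'a mat set)"
proof -
  let ?M = "carrier_mat m n :: 'a mat set"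
  define K where "K = {X \<in> ?M. f X = f (0\<^sub>m m n)}"
  note fin = finite_carrier_mat[of m n, where 'a = 'a]
  have fibre: "card {X \<in> ?M. f X = w} = card K" if w: "w \<in> f ` ?M" for w
  proof -
    obtain Z where Z: "Z \<in> ?M" "w = f Z" using w by auto
    have "f (X + Z) = f Z \<longleftrightarrow> f X = f (0\<^sub>m m n)" if "X \<in> ?M" for X
      using f[OF that zero_carrier_mat Z(1)] Z(1) by simp
    moreover have "X - Z + Z = X" "X + Z - Z = X" if "X \<in> ?M" for X
      using that Z(1) by (auto intro!: eq_matI)
    moreover have "X + Z \<in> ?M" "X - Z \<in> ?M" if "X \<in> ?M" for X
      using that Z(1) by auto
    ultimately have "bij_betw (\<lambda>X. X + Z) K {X \<in> ?M. f X = w}"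
      unfolding K_def Z(2)
      by (intro bij_betw_byWitness[where f' = "\<lambda>X. X - Z"] ballI image_subsetI CollectI conjI;
          elim CollectE conjE; metis)
    then show ?thesis by (metis bij_betw_same_card)
  qed
  have count: "card {X \<in> ?M. f X \<in> T} = card T * card K" if T: "T \<subseteq> f ` ?M" for T
  proof -
    have "card {X \<in> ?M. f X \<in> T} = card (\<Union>w\<in>T. {X \<in> ?M. f X = w})"
      by (rule arg_cong[where f = card]) auto
    also have "\<dots> = (\<Sum>w\<in>T. card {X \<in> ?M. f X = w})"
      using fin finite_subset[OF T] by (intro card_UN_disjoint) auto
    also have "\<dots> = card T * card K" using fibre T by (auto simp: subset_iff)
    finally show ?thesis .
  qed
  have "card ?M = card (f ` ?M) * card K"
  proof -
    have "{X \<in> ?M. f X \<in> f ` ?M} = ?M" by blast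
    then show ?thesis using count[of "f ` ?M"] by simp
  qed
  then show ?thesis using count[OF T] by simp
qed

lemma nonzero_vec_component:
  assumes "v \<in> carrier_vec n" "v \<noteq> 0\<^sub>v n"
  obtains i where "i < n" "v $ i \<noteq> 0"
  using assms by (metis carrier_vecD eq_vecI index_zero_vec(1) index_zero_vec(2))

text \<open>
  Since \<open>v\<close> and \<open>v'\<close> are not proportional, some \<open>2 \<times> 2\<close> minor \<open>d\<close> of the matrix with columns \<open>v\<close> and
  \<open>v'\<close> is nonzero. Each row of \<open>X\<close> is then found by Cramer's rule, with support in the two coordinates of
  that minor.
\<close>

lemma exists_mat_mult_two_vecs:
  fixes v v' :: "'a :: field vec"
  assumes v: "v \<in> carrier_vec n" "v \<noteq> 0\<^sub>v n" and v': "v' \<in> carrier_vec n" "\<And>c. v' \<noteq> c \<cdot>\<^sub>v v"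
    and w: "w \<in> carrier_vec m" "w' \<in> carrier_vec m"
  obtains X where "X \<in> carrier_mat m n" "X *\<^sub>v v = w" "X *\<^sub>v v' = w'"
proof -
  obtain i where i: "i < n" "v $ i \<noteq> 0" using nonzero_vec_component[OF v] .
  have "v' \<noteq> (v' $ i / v $ i) \<cdot>\<^sub>v v" by (rule v')
  then obtain j where j: "j < n" "v' $ j \<noteq> v' $ i / v $ i * v $ j"
    using v(1) v'(1) by (metis carrier_vecD eq_vecI index_smult_vec)
  define d where "d = v $ i * v' $ j - v' $ i * v $ j"
  have d: "d \<noteq> 0" using j i by (auto simp: d_def field_simps)
  define r where "r a b = ((a * v' $ j - b * v $ j) / d) \<cdot>\<^sub>v unit_vec n i
     + ((b * v $ i - a * v' $ i) / d) \<cdot>\<^sub>v unit_vec n j" for a b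
  have r: "r a b \<in> carrier_vec n" for a b by (simp add: r_def)
  have rv: "r a b \<bullet> u = (a * v' $ j - b * v $ j) / d * u $ i + (b * v $ i - a * v' $ i) / d * u $ j"
    if "u \<in> carrier_vec n" for a b u
    using that i j by (simp add: r_def add_scalar_prod_distrib[of _ n])
  have "(a * v' $ j - b * v $ j) * v $ i + (b * v $ i - a * v' $ i) * v $ j = a * d"
    "(a * v' $ j - b * v $ j) * v' $ i + (b * v $ i - a * v' $ i) * v' $ j = b * d" for a b
    by (simp_all add: d_def algebra_simps)
  then have rr: "r a b \<bullet> v = a" "r a b \<bullet> v' = b" for a b
    using d rv[OF v(1)] rv[OF v'(1)] by (simp_all add: divide_simps mult.commute)
  define X where "X = mat_of_rows n (map (\<lambda>k. r (w $ k) (w' $ k)) [0..<m])"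
  have "X \<in> carrier_mat m n" by (simp add: X_def mat_of_rows_def)
  moreover have "X *\<^sub>v v = w" "X *\<^sub>v v' = w'"
    using w r by (auto simp: X_def rr intro!: eq_vecI)
  ultimately show ?thesis using that by blast
qed

lemma exists_mat_mult_vec:
  fixes v :: "'a :: field vec"
  assumes v: "v \<in> carrier_vec n" "v \<noteq> 0\<^sub>v n" and w: "w \<in> carrier_vec m"
  obtains X where "X \<in> carrier_mat m n" "X *\<^sub>v v = w"
proof -
  obtain i where i: "i < n" "v $ i \<noteq> 0" using nonzero_vec_component[OF v] .
  define X where "X = mat_of_rows n (map (\<lambda>k. (w $ k / v $ i) \<cdot>\<^sub>v unit_vec n i) [0..<m])"
  have "X \<in> carrier_mat m n" by (simp add: X_def mat_of_rows_def)
  moreover have "X *\<^sub>v v = w" using w v i by (auto simp: X_def intro!: eq_vecI)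
  ultimately show ?thesis using that by blast
qed

lemma add_right_cancel_vec:
  fixes x y z :: "'a :: ab_group_add vec"
  assumes "x \<in> carrier_vec n" "y \<in> carrier_vec n" "z \<in> carrier_vec n"
  shows "x + z = y + z \<longleftrightarrow> x = y"
proof
  assume eq: "x + z = y + z"
  show "x = y"
  proof (rule eq_vecI)
    fix i assume "i < dim_vec y"
    then show "x $ i = y $ i" using assms arg_cong[OF eq, of "\<lambda>u. u $ i"] by auto
  qed (use assms in auto)
qed simp

lemma card_mat_mult_vec_in:
  fixes v :: "'a :: {field, finite} vec"
  assumes v: "v \<in> carrier_vec n" "v \<noteq> 0\<^sub>v n" and W: "W \<subseteq> carrier_vec m"
  shows "card {X \<in> carrier_mat m n. X *\<^sub>v v \<in> W} * CARD('a) ^ m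
    = card W * card (carrier_mat m n :: 'a mat set)"
proof -
  have img: "(\<lambda>X. X *\<^sub>v v) ` carrier_mat m n = carrier_vec m" (is "?f ` _ = _")
  proof (intro equalityI subsetI)
    fix w :: "'a vec" assume "w \<in> carrier_vec m"
    then show "w \<in> ?f ` carrier_mat m n" by (metis exists_mat_mult_vec[OF v] imageI)
  qed (use v in auto)
  show ?thesis
    using card_fibre_translation_invariant[of m n ?f W] W v(1)
    unfolding img card_carrier_vec
    by (simp add: add_mult_distrib_mat_vec[of _ m n] add_right_cancel_vec[of _ m])
qed

lemma card_mat_mult_two_vecs_in:
  fixes v v' :: "'a :: {field, finite} vec"
  assumes v: "v \<in> carrier_vec n" "v \<noteq> 0\<^sub>v n" and v': "v' \<in> carrier_vec n" "\<And>c. v' \<noteq> c \<cdot>\<^sub>v v"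
    and W: "W \<subseteq> carrier_vec m" "W' \<subseteq> carrier_vec m"
  shows "card {X \<in> carrier_mat m n. X *\<^sub>v v \<in> W \<and> X *\<^sub>v v' \<in> W'} * (CARD('a) ^ m) ^ 2
    = card W * card W' * card (carrier_mat m n :: 'a mat set)"
proof -
  have img: "(\<lambda>X. (X *\<^sub>v v, X *\<^sub>v v')) ` carrier_mat m n = carrier_vec m \<times> carrier_vec m"
    (is "?f ` _ = _")
  proof (intro equalityI subsetI)
    fix z :: "'a vec \<times> 'a vec" assume "z \<in> carrier_vec m \<times> carrier_vec m"
    then obtain w w' where z: "z = (w, w')" "w \<in> carrier_vec m" "w' \<in> carrier_vec m" by auto
    obtain X where "X \<in> carrier_mat m n" "X *\<^sub>v v = w" "X *\<^sub>v v' = w'"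
      using exists_mat_mult_two_vecs[OF v v' z(2,3)] .
    then show "z \<in> ?f ` carrier_mat m n" by (intro image_eqI[where x = X]) (simp_all add: z(1))
  qed (use v(1) v'(1) in auto)
  show ?thesis
    using card_fibre_translation_invariant[of m n ?f "W \<times> W'"] W v(1) v'(1)
    unfolding img card_cartesian_product card_carrier_vec
    by (simp add: add_mult_distrib_mat_vec[of _ m n] add_right_cancel_vec[of _ m]
        Sigma_mono power2_eq_square)
qed

section \<open>Representatives of the points of projective space\<close>

text \<open>
  The first nonzero entry; the bound on the index keeps the choice inside the vector, where
  multiplication by a scalar is known to act entrywise.
\<close>

definition leading_entry :: "'a :: zero vec \<Rightarrow> 'a" where
  "leading_entry v = v $ (LEAST i. v $ i \<noteq> 0 \<and> i < dim_vec v)"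

definition normalised_vecs :: "nat \<Rightarrow> 'a :: field vec set" where
  "normalised_vecs n = {v \<in> carrier_vec n. v \<noteq> 0\<^sub>v n \<and> leading_entry v = 1}"

lemma leading_entry_nonzero:
  assumes "v \<in> carrier_vec n" "v \<noteq> 0\<^sub>v n"
  shows "leading_entry v \<noteq> 0"
proof -
  obtain i where "i < n" "v $ i \<noteq> 0" using nonzero_vec_component[OF assms] .
  then have "v $ i \<noteq> 0 \<and> i < dim_vec v" using assms by auto
  from LeastI[where P = "\<lambda>i. v $ i \<noteq> 0 \<and> i < dim_vec v", OF this]
  show ?thesis by (simp add: leading_entry_def)
qed

lemma leading_entry_smult:
  fixes v :: "'a :: field vec"
  assumes "v \<in> carrier_vec n" "v \<noteq> 0\<^sub>v n" "c \<noteq> 0"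
  shows "leading_entry (c \<cdot>\<^sub>v v) = c * leading_entry v"
proof -
  have eq: "((c \<cdot>\<^sub>v v) $ i \<noteq> 0 \<and> i < dim_vec (c \<cdot>\<^sub>v v)) = (v $ i \<noteq> 0 \<and> i < dim_vec v)" for i
    using assms by auto
  obtain i where "i < n" "v $ i \<noteq> 0" using nonzero_vec_component[OF assms(1,2)] .
  then have "v $ i \<noteq> 0 \<and> i < dim_vec v" using assms by auto
  from LeastI[where P = "\<lambda>i. v $ i \<noteq> 0 \<and> i < dim_vec v", OF this]
  show ?thesis unfolding leading_entry_def eq by simp
qed

lemma smult_nonzero:
  fixes v :: "'a :: field vec"
  assumes "v \<in> carrier_vec n" "v \<noteq> 0\<^sub>v n" "c \<noteq> 0"
  shows "c \<cdot>\<^sub>v v \<noteq> 0\<^sub>v n"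
proof -
  obtain i where "i < n" "v $ i \<noteq> 0" using nonzero_vec_component[OF assms(1,2)] .
  then have "(c \<cdot>\<^sub>v v) $ i \<noteq> 0\<^sub>v n $ i" using assms by auto
  then show ?thesis by metis
qed

lemma normalised_vecs_not_proportional:
  assumes "v \<in> normalised_vecs n" "v' \<in> normalised_vecs n" "v \<noteq> v'"
  shows "v' \<noteq> c \<cdot>\<^sub>v v"
proof
  assume eq: "v' = c \<cdot>\<^sub>v v"
  have "c \<noteq> 0" using eq assms by (auto simp: normalised_vecs_def)
  then have "c = 1" using assms eq leading_entry_smult[of v n c]
    by (auto simp: normalised_vecs_def)
  then show False using eq assms by simp
qed

lemma nonzero_vec_eq_smult_normalised:
  fixes v :: "'a :: field vec"
  assumes "v \<in> carrier_vec n" "v \<noteq> 0\<^sub>v n"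
  obtains c u where "c \<noteq> 0" "u \<in> normalised_vecs n" "v = c \<cdot>\<^sub>v u"
proof
  let ?c = "leading_entry v"
  show c: "?c \<noteq> 0" by (rule leading_entry_nonzero[OF assms])
  show "inverse ?c \<cdot>\<^sub>v v \<in> normalised_vecs n"
    using assms c by (simp add: normalised_vecs_def leading_entry_smult[OF assms] smult_nonzero)
  show "v = ?c \<cdot>\<^sub>v (inverse ?c \<cdot>\<^sub>v v)" using c by (simp add: smult_smult_assoc)
qed

lemma finite_normalised_vecs: "finite (normalised_vecs n :: 'a :: {field, finite} vec set)"
  by (rule finite_subset[of _ "carrier_vec n"]) (auto simp: normalised_vecs_def)

text \<open>
  Every nonzero vector is a nonzero scalar times a normalised vector in exactly one way; the scalar is
  its leading entry.
\<close>

lemma card_normalised_vecs: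
  "(CARD('a) - 1) * card (normalised_vecs n :: 'a :: {field, finite} vec set) = CARD('a) ^ n - 1"
proof -
  let ?R = "normalised_vecs n :: 'a vec set"
  have "bij_betw (\<lambda>(c, u). c \<cdot>\<^sub>v u) ((UNIV - {0}) \<times> ?R) (carrier_vec n - {0\<^sub>v n})"
    unfolding bij_betw_def
  proof
    show "inj_on (\<lambda>(c, u). c \<cdot>\<^sub>v u) ((UNIV - {0}) \<times> ?R)"
    proof (clarsimp simp: inj_on_def)
      fix c d :: 'a and u v assume *: "c \<noteq> 0" "d \<noteq> 0" "u \<in> ?R" "v \<in> ?R" "c \<cdot>\<^sub>v u = d \<cdot>\<^sub>v v"
      have "leading_entry (c \<cdot>\<^sub>v u) = c" "leading_entry (d \<cdot>\<^sub>v v) = d"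
        using *(1-4) leading_entry_smult[of u n c] leading_entry_smult[of v n d]
        by (auto simp: normalised_vecs_def)
      then have cd: "c = d" using * by simp
      have "u = inverse c \<cdot>\<^sub>v (c \<cdot>\<^sub>v u)" "v = inverse d \<cdot>\<^sub>v (d \<cdot>\<^sub>v v)"
        using *(1,2) by (simp_all add: smult_smult_assoc)
      then show "c = d \<and> u = v" using cd *(5) by metis
    qed
    show "(\<lambda>(c, u). c \<cdot>\<^sub>v u) ` ((UNIV - {0}) \<times> ?R) = carrier_vec n - {0\<^sub>v n}"
    proof (intro equalityI subsetI)
      fix v :: "'a vec" assume "v \<in> carrier_vec n - {0\<^sub>v n}"
      then obtain c u where "c \<noteq> 0" "u \<in> ?R" "v = c \<cdot>\<^sub>v u"
        using nonzero_vec_eq_smult_normalised[of v n] by auto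
      then show "v \<in> (\<lambda>(c, u). c \<cdot>\<^sub>v u) ` ((UNIV - {0}) \<times> ?R)" by force
    qed (auto simp: normalised_vecs_def dest: smult_nonzero)
  qed
  then have "card ((UNIV - {0 :: 'a}) \<times> ?R) = card (carrier_vec n - {0\<^sub>v n :: 'a vec})"
    by (rule bij_betw_same_card)
  then show ?thesis
    by (simp add: card_cartesian_product card_Diff_singleton card_carrier_vec)
qed

section \<open>Colour classes and the number of invertible matrices\<close>

text \<open>
  The events of the second moment bound are \<open>X v \<in> S v\<close> for normalised \<open>v\<close>. The assumption on sums,
  used also for \<open>A = B\<close>, separates \<open>S v\<close> from \<open>- S v\<close> and so bounds their probabilities by \<open>1/2\<close>.
\<close>

lemma card_nonsingular_sums_bound:
  fixes S :: "'a :: {field, finite} mat set"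
  assumes S: "S \<subseteq> general_linear n"
    and sum: "\<And>A B. A \<in> S \<Longrightarrow> B \<in> S \<Longrightarrow> det (A + B) \<noteq> 0"
  shows "card S * card (normalised_vecs n :: 'a vec set) \<le> card (carrier_mat n n :: 'a mat set)"
proof -
  let ?M = "carrier_mat n n :: 'a mat set" and ?Q = "CARD('a) ^ n"
  define W where "W v = (\<lambda>A. A *\<^sub>v v) ` S" for v
  define B where "B v = {X \<in> ?M. X *\<^sub>v v \<in> W v}" for v
  have SM: "S \<subseteq> ?M" using S by (auto simp: general_linear_def)
  have Q: "?Q > 0" by simp
  have Wc: "W v \<subseteq> carrier_vec n" if "v \<in> normalised_vecs n" for v
    using SM that by (auto simp: W_def normalised_vecs_def)
  have cardB: "card (B v) * ?Q = card (W v) * card ?M" if "v \<in> normalised_vecs n" for v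
    unfolding B_def using that Wc[OF that]
    by (intro card_mat_mult_vec_in) (auto simp: normalised_vecs_def)
  show ?thesis
  proof (rule pairwise_independent_events_bound[where B = B])
    fix v :: "'a vec" assume v: "v \<in> normalised_vecs n"
    then have v0: "v \<in> carrier_vec n" "v \<noteq> 0\<^sub>v n" by (auto simp: normalised_vecs_def)
    have "W v \<inter> uminus ` W v = {}"
    proof (rule ccontr)
      assume "W v \<inter> uminus ` W v \<noteq> {}"
      then obtain X Y where XY: "X \<in> S" "Y \<in> S" "X *\<^sub>v v = - (Y *\<^sub>v v)"
        by (auto simp: W_def)
      then have c: "X \<in> ?M" "Y \<in> ?M" using SM by auto
      have "(X + Y) *\<^sub>v v = 0\<^sub>v n"
        using XY(3) c v0 by (simp add: add_mult_distrib_mat_vec[of _ n n])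
      then have "det (X + Y) = 0"
        using c v0 det_0_iff_vec_prod_zero[of "X + Y" n] by auto
      then show False using sum XY by blast
    qed
    moreover have "card (uminus ` W v) = card (W v)"
      by (rule card_image) (metis inj_onI uminus_uminus_vec)
    moreover have "finite (W v)" using Wc[OF v] finite_carrier_vec finite_subset by blast
    ultimately have "2 * card (W v) = card (W v \<union> uminus ` W v)"
      by (simp add: card_Un_disjoint)
    also have "\<dots> \<le> card (carrier_vec n :: 'a vec set)"
      using Wc[OF v] by (intro card_mono) (auto dest: uminus_carrier_vec[THEN iffD2])
    finally have "2 * card (W v) \<le> ?Q" by (simp add: card_carrier_vec)
    then have "2 * card (W v) * card ?M \<le> ?Q * card ?M" by (rule mult_right_mono) simp
    then have "?Q * (2 * card (B v)) \<le> ?Q * card ?M"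
      using cardB[OF v] by (metis mult.assoc mult.commute)
    then show "2 * card (B v) \<le> card ?M" using Q by simp
  next
    fix v u :: "'a vec"
    assume vu: "v \<in> normalised_vecs n" "u \<in> normalised_vecs n" "v \<noteq> u"
    have "B v \<inter> B u = {X \<in> ?M. X *\<^sub>v v \<in> W v \<and> X *\<^sub>v u \<in> W u}" by (auto simp: B_def)
    then have "card (B v \<inter> B u) * ?Q ^ 2 = card (W v) * card (W u) * card ?M"
      using card_mat_mult_two_vecs_in[of v n u "W v" n "W u"] vu Wc
        normalised_vecs_not_proportional[OF vu]
      by (simp add: normalised_vecs_def)
    then have "card ?M * card (B v \<inter> B u) * ?Q ^ 2
        = (card (W v) * card ?M) * (card (W u) * card ?M)" by (simp add: algebra_simps)
    also have "\<dots> = card (B v) * card (B u) * ?Q ^ 2"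
      using cardB vu by (simp add: power2_eq_square flip: cardB)
    finally show "card ?M * card (B v \<inter> B u) = card (B v) * card (B u)" by simp
  qed (use finite_normalised_vecs finite_carrier_mat SM in \<open>auto simp: B_def W_def\<close>)
qed

text \<open>
  The kernel of a singular matrix contains a normalised vector, and a fixed nonzero vector is killed by the
  fraction \<open>1 / q ^ n\<close> of all matrices.
\<close>

lemma card_singular_bound:
  "card {X \<in> carrier_mat n n :: 'a :: {field, finite} mat set. det X = 0} * CARD('a) ^ n
    \<le> card (normalised_vecs n :: 'a vec set) * card (carrier_mat n n :: 'a mat set)"
proof -
  let ?M = "carrier_mat n n :: 'a mat set" and ?R = "normalised_vecs n :: 'a vec set"
  have "{X \<in> ?M. det X = 0} \<subseteq> (\<Union>u\<in>?R. {X \<in> ?M. X *\<^sub>v u \<in> {0\<^sub>v n}})"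
  proof clarsimp
    fix X :: "'a mat" assume X: "X \<in> ?M" "det X = 0"
    then obtain v where v: "v \<in> carrier_vec n" "v \<noteq> 0\<^sub>v n" "X *\<^sub>v v = 0\<^sub>v n"
      using det_0_iff_vec_prod_zero by blast
    obtain c u where u: "c \<noteq> 0" "u \<in> ?R" "v = c \<cdot>\<^sub>v u"
      using nonzero_vec_eq_smult_normalised[OF v(1,2)] .
    have "c \<cdot>\<^sub>v (X *\<^sub>v u) = 0\<^sub>v n"
      using u v X by (auto simp: normalised_vecs_def mult_mat_vec)
    moreover have "X *\<^sub>v u \<in> carrier_vec n" using X u by (auto simp: normalised_vecs_def)
    ultimately have "X *\<^sub>v u = 0\<^sub>v n" using u(1) smult_nonzero by blast
    then show "\<exists>u\<in>?R. X *\<^sub>v u = 0\<^sub>v n" using u by blast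
  qed
  then have "card {X \<in> ?M. det X = 0} \<le> card (\<Union>u\<in>?R. {X \<in> ?M. X *\<^sub>v u \<in> {0\<^sub>v n}})"
    by (intro card_mono finite_UN_I finite_normalised_vecs)
      (simp_all add: finite_carrier_mat)
  also have "\<dots> \<le> (\<Sum>u\<in>?R. card {X \<in> ?M. X *\<^sub>v u \<in> {0\<^sub>v n}})"
    using finite_normalised_vecs by (rule card_UN_le)
  finally have "card {X \<in> ?M. det X = 0} * CARD('a) ^ n
      \<le> (\<Sum>u\<in>?R. card {X \<in> ?M. X *\<^sub>v u \<in> {0\<^sub>v n}}) * CARD('a) ^ n" by simp
  also have "\<dots> = (\<Sum>u\<in>?R. card ?M)"
    unfolding sum_distrib_right
  proof (rule sum.cong[OF refl])
    fix u assume "u \<in> ?R"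
    then show "card {X \<in> ?M. X *\<^sub>v u \<in> {0\<^sub>v n}} * CARD('a) ^ n = card ?M"
      using card_mat_mult_vec_in[of u n "{0\<^sub>v n}" n] by (simp add: normalised_vecs_def)
  qed
  finally show ?thesis by simp
qed

lemma card_general_linear_bound:
  "card (carrier_mat n n :: 'a :: {field, finite} mat set) * CARD('a) ^ n
    \<le> card (general_linear n :: 'a mat set) * CARD('a) ^ n
      + card (normalised_vecs n :: 'a vec set) * card (carrier_mat n n :: 'a mat set)"
proof -
  let ?M = "carrier_mat n n :: 'a mat set"
  have "?M = general_linear n \<union> {X \<in> ?M. det X = 0}" by (auto simp: general_linear_def)
  then have "card ?M \<le> card (general_linear n :: 'a mat set) + card {X \<in> ?M. det X = 0}"
    by (metis card_Un_le)
  then have "card ?M * CARD('a) ^ n \<le> (card (general_linear n :: 'a mat set)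
      + card {X \<in> ?M. det X = 0}) * CARD('a) ^ n" by (rule mult_right_mono) simp
  then show ?thesis using card_singular_bound[of n, where 'a = 'a] by (simp add: algebra_simps)
qed

section \<open>The chromatic number in odd and in even characteristic\<close>

text \<open>
  The colour classes cover the invertible matrices, and none is larger than \<open>card_nonsingular_sums_bound\<close>
  permits. The characteristic enters only through \<open>det (A + A) = 2 ^ n * det A\<close>, which has to be nonzero.
\<close>

lemma chromatic_number_normalised_bound:
  assumes two: "(1 + 1 :: 'a :: {field, finite}) \<noteq> 0"
  shows "card (normalised_vecs n :: 'a vec set)
      * (CARD('a) ^ n - card (normalised_vecs n :: 'a vec set))
    \<le> chromatic_number (regular_graph n :: 'a mat pair_pre_digraph) * CARD('a) ^ n"
proof -
  let ?G = "regular_graph n :: 'a mat pair_pre_digraph" and ?Q = "CARD('a) ^ n"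
  let ?M = "carrier_mat n n :: 'a mat set" and ?R = "normalised_vecs n :: 'a vec set"
  let ?L = "general_linear n :: 'a mat set"
  define k where "k = chromatic_number ?G"
  obtain c where c: "c ` pverts ?G \<subseteq> {..<k}" and pc: "proper_colouring ?G c"
    using colourable_chromatic_number[OF pair_graph_regular_graph[of n]]
    unfolding colourable_def k_def by blast
  have cls: "card {A \<in> ?L. c A = i} * card ?R \<le> card ?M" for i
  proof (rule card_nonsingular_sums_bound)
    fix A B assume A: "A \<in> {A \<in> ?L. c A = i}" and B: "B \<in> {A \<in> ?L. c A = i}"
    show "det (A + B) \<noteq> 0"
    proof (cases "A = B")
      case True
      have "A + A = (1 + 1) \<cdot>\<^sub>m A" by (intro eq_matI) (auto simp: algebra_simps)
      then show ?thesis using True A two by (simp add: det_smult general_linear_def)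
    next
      case False
      have "(A, B) \<notin> parcs ?G"
        using pc A B by (auto simp: proper_colouring_def)
      then show ?thesis using False A B by (simp add: regular_graph_def)
    qed
  qed auto
  have "?L = (\<Union>i<k. {A \<in> ?L. c A = i})" using c by (auto simp: regular_graph_def)
  then have "card ?L \<le> (\<Sum>i<k. card {A \<in> ?L. c A = i})"
    using card_UN_le[of "{..<k}" "\<lambda>i. {A \<in> ?L. c A = i}"] by simp
  then have "card ?L * card ?R \<le> (\<Sum>i<k. card {A \<in> ?L. c A = i} * card ?R)"
    by (simp flip: sum_distrib_right)
  also have "\<dots> \<le> k * card ?M" using sum_mono[of "{..<k}", OF cls] by simp
  finally have 1: "card ?L * card ?R \<le> k * card ?M" .
  have "card ?M * (?Q - card ?R) \<le> card ?L * ?Q"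
    using card_general_linear_bound[of n, where 'a = 'a]
    by (simp add: diff_mult_distrib2 mult.commute le_diff_conv)
  then have "card ?R * (card ?M * (?Q - card ?R)) \<le> card ?R * (card ?L * ?Q)"
    by (rule mult_left_mono) simp
  also have "\<dots> \<le> k * card ?M * ?Q" using mult_right_mono[OF 1, of ?Q] by (simp add: ac_simps)
  finally have "card ?M * (card ?R * (?Q - card ?R)) \<le> card ?M * (k * ?Q)"
    by (simp add: ac_simps)
  moreover have "card ?M > 0"
    using finite_carrier_mat[of n n, where 'a = 'a] zero_carrier_mat
    by (metis card_gt_0_iff empty_iff)
  ultimately show ?thesis by (simp add: k_def)
qed

text \<open>
  The matrices \<open>t u\<close> of the proof, the identity with \<open>u\<close> written to the right of the diagonal
  in the first row, form a clique: the sum of two of them kills the first unit vector because \<open>1 + 1 = 0\<close>.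
\<close>

lemma chromatic_number_char_two_bound:
  assumes two: "(1 + 1 :: 'a :: {field, finite}) = 0" and n: "n \<ge> 2"
  shows "CARD('a) ^ (n - 1) \<le> chromatic_number (regular_graph n :: 'a mat pair_pre_digraph)"
proof -
  let ?G = "regular_graph n :: 'a mat pair_pre_digraph"
  define k where "k = chromatic_number ?G"
  obtain c where c: "c ` pverts ?G \<subseteq> {..<k}" and pc: "proper_colouring ?G c"
    using colourable_chromatic_number[OF pair_graph_regular_graph[of n]]
    unfolding colourable_def k_def by blast
  define t :: "'a vec \<Rightarrow> 'a mat" where
    "t u = mat n n (\<lambda>(i, j). if i = j then 1 else if i = 0 then u $ (j - 1) else 0)" for u
  have tc: "t u \<in> carrier_mat n n" for u by (simp add: t_def)
  have "det (t u) = 1" for u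
  proof -
    have "upper_triangular (t u)" by (auto simp: t_def)
    moreover have "diag_mat (t u) = replicate n 1"
      by (auto simp: diag_mat_def t_def intro: nth_equalityI)
    ultimately show ?thesis using det_upper_triangular[OF _ tc] by simp
  qed
  then have tL: "t u \<in> general_linear n" for u by (simp add: general_linear_def tc)
  have sing: "det (t u + t v) = 0" for u v
  proof -
    have "(t u + t v) *\<^sub>v unit_vec n 0 = 0\<^sub>v n"
      using n two tc by (intro eq_vecI) (auto simp: t_def)
    moreover have "unit_vec n 0 \<noteq> (0\<^sub>v n :: 'a vec)" using n by simp
    ultimately show ?thesis
      using det_0_iff_vec_prod_zero[of "t u + t v" n] tc by (meson add_carrier_mat unit_vec_carrier)
  qed
  have tinj: "u = v" if "u \<in> carrier_vec (n - 1)" "v \<in> carrier_vec (n - 1)" "t u = t v" for u v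
  proof (rule eq_vecI)
    fix j assume "j < dim_vec v"
    then show "u $ j = v $ j"
      using that(1,2) arg_cong[OF that(3), of "\<lambda>A. A $$ (0, Suc j)"] by (simp add: t_def)
  qed (use that in auto)
  have "inj_on (\<lambda>u. c (t u)) (carrier_vec (n - 1))"
  proof (rule inj_onI)
    fix u v assume uv: "u \<in> carrier_vec (n - 1)" "v \<in> carrier_vec (n - 1)" "c (t u) = c (t v)"
    have "(t u, t v) \<notin> parcs ?G" using pc uv(3) by (auto simp: proper_colouring_def)
    then have "t u = t v" using tL sing by (simp add: regular_graph_def)
    then show "u = v" by (rule tinj[OF uv(1,2)])
  qed
  moreover have "(\<lambda>u. c (t u)) ` carrier_vec (n - 1) \<subseteq> {..<k}"
    using c tL by (auto simp: regular_graph_def)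
  ultimately have "card (carrier_vec (n - 1) :: 'a vec set) \<le> card {..<k}"
    by (intro card_inj_on_le) auto
  then show ?thesis by (simp add: card_carrier_vec k_def)
qed

text \<open>
  The function \<open>x \<mapsto> x (q ^ n - x)\<close> increases up to \<open>q ^ n / 2\<close>, so \<open>r\<close> may be replaced by its two leading
  terms \<open>s = q ^ (n - 1) + q ^ (n - 2)\<close>. The assumption \<open>q \<ge> 3\<close> is what keeps \<open>r\<close> below \<open>q ^ n / 2\<close>.
\<close>

lemma concave_count_bound:
  fixes q :: real
  assumes q: "q \<ge> 3" and n: "n \<ge> 2" and r: "(q - 1) * r = q ^ n - 1"
  shows "(1 - 1 / q - 1 / q ^ 2) * q ^ (n - 1) * q ^ n \<le> r * (q ^ n - r)"
proof -
  obtain m where m: "n = m + 2" using n by (metis add.commute le_Suc_ex)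
  define s where "s = q ^ m * (q + 1)"
  have Q: "q ^ n = q ^ m * q\<^sup>2" unfolding m by (rule power_add)
  have qm: "q ^ m \<ge> 1" using q by (simp add: one_le_power)
  have "(q - 1) * s = q ^ n - q ^ m" by (simp add: s_def Q power2_eq_square algebra_simps)
  then have "(q - 1) * s \<le> (q - 1) * r" using r qm by simp
  then have sr: "s \<le> r" using q by simp
  have s0: "s \<ge> 0" using q by (simp add: s_def)
  have "2 * r \<le> (q - 1) * r" using q sr s0 by (intro mult_right_mono) auto
  then have "r + s \<le> q ^ n" using r sr by linarith
  then have "0 \<le> (r - s) * (q ^ n - r - s)" using sr by (intro mult_nonneg_nonneg) auto
  then have "s * (q ^ n - s) \<le> r * (q ^ n - r)" by (simp add: algebra_simps)
  moreover have "(1 - 1 / q - 1 / q ^ 2) * q ^ (n - 1) * q ^ n = (q ^ m)\<^sup>2 * q * (q\<^sup>2 - q - 1)"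
    using q by (simp add: m power_add field_simps power2_eq_square)
  moreover have "s * (q ^ n - s) = (q ^ m)\<^sup>2 * (q + 1) * (q\<^sup>2 - q - 1)"
    by (simp add: s_def Q power2_eq_square algebra_simps)
  moreover have "(q ^ m)\<^sup>2 * q * (q\<^sup>2 - q - 1) \<le> (q ^ m)\<^sup>2 * (q + 1) * (q\<^sup>2 - q - 1)"
  proof (intro mult_right_mono mult_left_mono)
    have "q * (q - 1) \<ge> 3 * 2" using q by (intro mult_mono) auto
    then show "0 \<le> q\<^sup>2 - q - 1" by (simp add: power2_eq_square algebra_simps)
  qed auto
  ultimately show ?thesis by linarith
qed

theorem theorem1p2:
  fixes n q :: nat
  assumes "q = CARD('a :: {field, finite})"
    and "n \<ge> 2"
  shows "real (chromatic_number (regular_graph n :: 'a mat pair_pre_digraph))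
           \<ge> (1 - 1 / real q - 1 / real q ^ 2) * real q ^ (n - 1)"
proof (cases "(1 + 1 :: 'a) = 0")
  case True
  have "(1 - 1 / real q - 1 / real q ^ 2) * real q ^ (n - 1) \<le> 1 * real q ^ (n - 1)"
  proof (rule mult_right_mono)
    have "0 \<le> 1 / real q" "0 \<le> 1 / real q ^ 2" by simp_all
    then show "1 - 1 / real q - 1 / real q ^ 2 \<le> 1" by linarith
  qed simp
  also have "\<dots> \<le> real (chromatic_number (regular_graph n :: 'a mat pair_pre_digraph))"
    using chromatic_number_char_two_bound[OF True assms(2)] unfolding assms(1)
    by (metis mult_1 of_nat_le_iff of_nat_power)
  finally show ?thesis .
next
  case False
  let ?R = "normalised_vecs n :: 'a vec set"
  define k where "k = chromatic_number (regular_graph n :: 'a mat pair_pre_digraph)"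
  \<comment> \<open>Odd characteristic forces \<open>q \<ge> 3\<close>, since \<open>0\<close>, \<open>1\<close> and \<open>-1\<close> are distinct.\<close>
  have "card {0, 1, - 1 :: 'a} = 3"
    using False by (auto simp: card_insert_if eq_neg_iff_add_eq_0)
  then have q3: "q \<ge> 3" unfolding assms(1) by (metis card_mono finite subset_UNIV)
  have cardR: "(q - 1) * card ?R = q ^ n - 1"
    using card_normalised_vecs[of n, where 'a = 'a] assms(1) by simp
  have "1 \<le> q ^ n" using q3 by simp
  with cardR q3 have r: "(real q - 1) * real (card ?R) = real q ^ n - 1"
    by (smt (verit) of_nat_1 of_nat_diff of_nat_mult of_nat_power le_trans one_le_numeral)
  have "card ?R \<le> q ^ n"
    using card_mono[of "carrier_vec n :: 'a vec set" ?R] assms(1)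
    by (auto simp: normalised_vecs_def card_carrier_vec)
  moreover have "real (card ?R * (q ^ n - card ?R)) \<le> real (k * q ^ n)"
    using chromatic_number_normalised_bound[OF False, of n] assms(1) k_def
    by (metis of_nat_le_iff)
  ultimately have "real (card ?R) * (real q ^ n - real (card ?R)) \<le> real k * real q ^ n"
    by (simp add: of_nat_diff)
  with concave_count_bound[OF _ assms(2) r] q3
  have "(1 - 1 / real q - 1 / real q ^ 2) * real q ^ (n - 1) * real q ^ n \<le> real k * real q ^ n"
    by linarith
  then show ?thesis
    unfolding k_def by (rule mult_right_le_imp_le) (use q3 in simp)
qed

end
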